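(* Let $G$ and $H$ be two finite simple graphs of order $n$ with adjacency matrices $A$ and $B$ respectively, and suppose that the $2$-dimensional Weisfeiler--Leman algorithm cannot distinguish $G$ and $H$, i.e. $G \cong_{2\text{-WL}} H$. Let $V=\bigsqcup_{i=1}^p V_i$ be the partition of the vertex set of $G$ according to vertex degree (each $V_i$ is the set of all vertices of one fixed degree), and let $e_i\in\{0,1\}^V$ be the characteristic vector of $V_i$. Let $$\widetilde{W}_A=[e_1, Ae_1,\ldots,A^{n-1}e_1,\ e_2, Ae_2,\ldots,A^{n-1}e_2,\ \ldots,\ e_p, Ae_p,\ldots,A^{n-1}e_p]$$ (an $n\times np$ integral matrix) and let $d_n(\widetilde{W}_A)$ be its last invariant factor. If $d_n(\widetilde{W}_A)$ is odd and for every odd prime $q$ dividing $d_n(\widetilde{W}_A)$ the integer $q^2$ does not divide the discriminant $\Delta_A$ of $A$, then $G$ and $H$ are isomorphic. In particular, if $d_n(\widetilde{W}_A)=1$ then $G$ and $H$ are isomorphic. The same statements hold with the roles of $G,A$ replaced by $H,B$ (using the degree partition of $H$ and $\widetilde W_B$).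
   Context: Graphs are finite, simple, undirected, without loops. The adjacency matrix $A_G$ has $A_G(u,v)=1$ if $uv$ is an edge and $0$ otherwise. Smith normal form: every $n\times m$ integral matrix $M$ can be written $M=U\Sigma V$ with $U$ ($n\times n$) and $V$ ($m\times m$) unimodular integral matrices (determinant $\pm1$) and $\Sigma$ an $n\times m$ diagonal matrix with diagonal entries $d_1\mid d_2\mid\cdots\mid d_{\min(n,m)}$ (nonnegative); $d_{\min(n,m)}$ is called the last invariant factor of $M$ (it is $0$ if $M$ has rank less than $\min(n,m)$). The discriminant of a square matrix $M$ of order $n$ with eigenvalues $\lambda_1,\dots,\lambda_n$ is $\Delta_M=\prod_{i<j}(\lambda_i-\lambda_j)^2$ (a nonnegative integer when $M$ is integral symmetric). $2$-WL equivalence. For a matrix $A:V\times V\to C$ (entries in a set $C$) and $k\ge1$, the atomic type $\mathrm{tp}_A(i_1,\dots,i_k)$ of a $k$-tuple in $V^k$ is the $k\times k$ array $T$ with $T_{p,q}=(0,A(i_p,i_q))$ if $i_p=i_q$ and $T_{p,q}=(1,A(i_p,i_q))$ if $i_p\ne i_q$. Colorings $X^r_{A,k}:V^k\to S$ are defined by $X^1_{A,k}=\mathrm{tp}_A$ and $$X^{r+1}_{A,k}(i_1\dots i_k)=\Big(X^r_{A,k}(i_1\dots i_k),\ \{\!\{(\mathrm{tp}_A(i_1\dots i_k m),\,S^r_{A,k}(i_1\dots i_k m)) : m\in V\}\!\}\Big),$$ where $\{\!\{\cdot\}\!\}$ denotes a multiset and $S^r_{A,k}(i_1\dots i_k m)$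 is the sequence $(X^r_{A,k}(i_1\dots i_{\ell-1}\,m\,i_{\ell+1}\dots i_k))_{\ell=k,k-1,\dots,1}$ (replace the $\ell$-th entry by $m$). Colors are abstract objects built this way, so colors arising from different matrices can be compared. Let $M^r_{A,k}$ be the multiset $\{\!\{X^r_{A,k}(x):x\in V^k\}\!\}$ and $I_{A,k}(t)=\sum_{r\ge1}t^rM^r_{A,k}$ (a formal series). Two graphs $G,H$ satisfy $G\cong_{2\text{-WL}}H$ if $I_{A_G,2}(t)=I_{A_H,2}(t)$. *)

theory Defs
  imports
    "HOL-Library.Multiset"
    "HOL-Computational_Algebra.Formal_Power_Series"
    "HOL-Computational_Algebra.Primes"
    "Graph_Theory.Graph_Theory"
    "Jordan_Normal_Form.Char_Poly"
begin

section \<open>Graphs and their matrices\<close>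

text \<open>
  A finite simple undirected graph is a \<open>pair_graph\<close>: a finite vertex set with a symmetric,
  irreflexive adjacency relation \<open>parcs G\<close> on it. An edge \<open>uv\<close> is the pair of arcs \<open>(u, v)\<close>,
  \<open>(v, u)\<close>, so \<open>out_degree\<close> is the vertex degree.
\<close>

definition adjacency :: "'a pair_pre_digraph \<Rightarrow> 'a \<Rightarrow> 'a \<Rightarrow> int" where
  "adjacency G u v = (if (u, v) \<in> parcs G then 1 else 0)"

definition vertex_enumeration :: "'a pair_pre_digraph \<Rightarrow> 'a list \<Rightarrow> bool" where
  "vertex_enumeration G vs \<longleftrightarrow> distinct vs \<and> set vs = pverts G"

definition adjacency_mat :: "'a pair_pre_digraph \<Rightarrow> 'a list \<Rightarrow> int mat" where
  "adjacency_mat G vs = mat (length vs) (length vs) (\<lambda>(i, j). adjacency G (vs ! i) (vs ! j))"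

definition degree_partition :: "'a pair_pre_digraph \<Rightarrow> 'a set set" where
  "degree_partition G =
     (\<lambda>v. {u \<in> pverts G. out_degree (with_proj G) u = out_degree (with_proj G) v}) ` pverts G"

definition degree_cell_enumeration :: "'a pair_pre_digraph \<Rightarrow> 'a set list \<Rightarrow> bool" where
  "degree_cell_enumeration G Vs \<longleftrightarrow> distinct Vs \<and> set Vs = degree_partition G"

definition char_vec :: "'a list \<Rightarrow> 'a set \<Rightarrow> int vec" where
  "char_vec vs C = vec (length vs) (\<lambda>i. if vs ! i \<in> C then 1 else 0)"

definition walk_matrix :: "'a pair_pre_digraph \<Rightarrow> 'a list \<Rightarrow> 'a set list \<Rightarrow> int mat" where
  "walk_matrix G vs Vs =
     (let n = length vs; A = adjacency_mat G vs
      in mat_of_cols n (concat (map (\<lambda>C. map (\<lambda>k. (A ^\<^sub>m k) *\<^sub>v char_vec vs C) [0..<n]) Vs)))"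

section \<open>Smith normal form and discriminant\<close>

definition smith_normal_form :: "int mat \<Rightarrow> int mat \<Rightarrow> bool" where
  "smith_normal_form M S \<longleftrightarrow>
     (let n = dim_row M; m = dim_col M in
       S \<in> carrier_mat n m \<and> diagonal_mat S \<and>
       (\<forall>i < min n m. 0 \<le> S $$ (i, i)) \<and>
       (\<forall>i. Suc i < min n m \<longrightarrow> S $$ (i, i) dvd S $$ (Suc i, Suc i)) \<and>
       (\<exists>U \<in> carrier_mat n n. \<exists>V \<in> carrier_mat m m.
          det U \<in> {1, -1} \<and> det V \<in> {1, -1} \<and> M = U * S * V))"

text \<open>
  \<open>last_invariant_factor M d\<close> says that \<open>d\<close> is the last invariant factor of \<open>M\<close>. It is a relation
  so that no choice among the Smith decompositions of \<open>M\<close> is involved; a matrix without rows or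
  without columns has no last invariant factor.
\<close>

definition last_invariant_factor :: "int mat \<Rightarrow> int \<Rightarrow> bool" where
  "last_invariant_factor M d \<longleftrightarrow>
     (let l = min (dim_row M) (dim_col M) in
       0 < l \<and> (\<exists>S. smith_normal_form M S \<and> d = S $$ (l - 1, l - 1)))"

text \<open>The eigenvalues with algebraic multiplicity, in an arbitrary order.\<close>

definition eigenvalues :: "complex mat \<Rightarrow> complex list" where
  "eigenvalues M = (SOME es. length es = dim_row M \<and> char_poly M = (\<Prod>e\<leftarrow>es. [:- e, 1:]))"

lemma eigenvalues:
  assumes "M \<in> carrier_mat n n"
  shows "length (eigenvalues M) = n" "char_poly M = (\<Prod>e\<leftarrow>eigenvalues M. [:- e, 1:])"
proof -
  have "\<exists>es. length es = dim_row M \<and> char_poly M = (\<Prod>e\<leftarrow>es. [:- e, 1:])"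
    using char_poly_factorized[OF assms] assms by auto
  from someI_ex[OF this, folded eigenvalues_def] assms
  show "length (eigenvalues M) = n" "char_poly M = (\<Prod>e\<leftarrow>eigenvalues M. [:- e, 1:])"
    by auto
qed

text \<open>The squares make the product independent of the order of the eigenvalues.\<close>

definition discriminant :: "complex mat \<Rightarrow> complex" where
  "discriminant M =
     (let es = eigenvalues M in
       \<Prod>j < length es. \<Prod>i < j. (es ! i - es ! j)\<^sup>2)"

text \<open>
  For an integral matrix, divisibility of its discriminant by an integer is divisibility in the
  integers; the relation \<open>dvd\<close> on complex numbers would be trivial.
\<close>

definition dvd_discriminant :: "int \<Rightarrow> int mat \<Rightarrow> bool" where
  "dvd_discriminant a M \<longleftrightarrow>
     (\<exists>k :: int. discriminant (map_mat of_int M) = of_int (a * k))"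

section \<open>The Weisfeiler--Leman algorithm\<close>

text \<open>Tuples in \<open>V\<^sup>k\<close> are lists of length \<open>k\<close>; the \<open>k \<times> k\<close> array is the list of its rows.\<close>

definition atomic_type :: "('v \<Rightarrow> 'v \<Rightarrow> 'c) \<Rightarrow> 'v list \<Rightarrow> (nat \<times> 'c) list list" where
  "atomic_type A xs = map (\<lambda>x. map (\<lambda>y. (if x = y then 0 else 1, A x y)) xs) xs"

text \<open>The colors do not mention the vertices, so colors of different matrices are comparable.\<close>

datatype 'c wl_color =
    Atomic "(nat \<times> 'c) list list"
  | Refined "'c wl_color" "((nat \<times> 'c) list list \<times> 'c wl_color list) multiset"

text \<open>
  \<open>wl_coloring V A r\<close> is the coloring \<open>X\<^bsup>r+1\<^esup>\<close>, the rounds of the algorithm being numbered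
  from 1; \<open>k\<close> is the length of the argument.
\<close>

primrec wl_coloring :: "'v set \<Rightarrow> ('v \<Rightarrow> 'v \<Rightarrow> 'c) \<Rightarrow> nat \<Rightarrow> 'v list \<Rightarrow> 'c wl_color" where
  "wl_coloring V A 0 = (\<lambda>xs. Atomic (atomic_type A xs))"
| "wl_coloring V A (Suc r) = (\<lambda>xs.
     Refined (wl_coloring V A r xs)
       (image_mset
          (\<lambda>m. (atomic_type A (xs @ [m]),
                map (\<lambda>l. wl_coloring V A r (xs[l := m])) (rev [0..<length xs])))
          (mset_set V)))"

definition wl_multiset :: "'v set \<Rightarrow> ('v \<Rightarrow> 'v \<Rightarrow> 'c) \<Rightarrow> nat \<Rightarrow> nat \<Rightarrow> 'c wl_color multiset" where
  "wl_multiset V A k r =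
     image_mset (wl_coloring V A r) (mset_set {xs. set xs \<subseteq> V \<and> length xs = k})"

definition wl_series :: "'v set \<Rightarrow> ('v \<Rightarrow> 'v \<Rightarrow> 'c) \<Rightarrow> nat \<Rightarrow> 'c wl_color multiset fps" where
  "wl_series V A k = Abs_fps (\<lambda>r. case r of 0 \<Rightarrow> {#} | Suc s \<Rightarrow> wl_multiset V A k s)"

definition wl_equivalent :: "nat \<Rightarrow> 'a pair_pre_digraph \<Rightarrow> 'b pair_pre_digraph \<Rightarrow> bool" where
  "wl_equivalent k G H \<longleftrightarrow>
     wl_series (pverts G) (adjacency G) k = wl_series (pverts H) (adjacency H) k"

end

theory Submission
  imports Defs
begin

text \<open>
  If $d_n(\widetilde W_A) \neq 0$, no two rows of the walk matrix coincide. The row of a vertex $u$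
  lists the numbers of walks of each length from $u$ to the vertices of each degree, and these
  numbers are functions of the 2-WL color of any pair containing $u$. Hence these row profiles
  separate the vertices of $G$; counting, they also separate the vertices of $H$, and identifying
  the vertices with equal profiles is an isomorphism, since the color of a pair also records
  adjacency.
\<close>

section \<open>Walk counts are determined by Weisfeiler--Leman colors\<close>

text \<open>Entry \<open>(u, v)\<close> of the \<open>k\<close>-th matrix power, indexed by vertices
  instead of positions so that it can be related to colors. The new step is appended at the end,
  matching the recursion of \<open>^\<^sub>m\<close>.\<close>

primrec walks :: "'v set \<Rightarrow> ('v \<Rightarrow> 'v \<Rightarrow> int) \<Rightarrow> nat \<Rightarrow> 'v \<Rightarrow> 'v \<Rightarrow> int" where
  "walks V A 0 u v = (if u = v then 1 else 0)"
| "walks V A (Suc k) u v = (\<Sum>m\<in>V. walks V A k u m * A m v)"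

text \<open>A row of the walk matrix with cells replaced by degree values \<open>d\<close>, so that
  vertices of different graphs can be compared. The cutoff at \<open>card V\<close> keeps exactly
  the powers in the matrix and lets one fixed round determine the whole function.\<close>

definition walk_profile :: "'v set \<Rightarrow> ('v \<Rightarrow> 'v \<Rightarrow> int) \<Rightarrow> 'v \<Rightarrow> nat \<Rightarrow> int \<Rightarrow> int" where
  "walk_profile V A u k d =
     (if k < card V then \<Sum>v\<in>V. walks V A k u v * (if (\<Sum>m\<in>V. A v m) = d then 1 else 0) else 0)"

text \<open>Through \<open>rel_mset\<close>, the multiset equality matches the elements of
  \<open>V\<close> with those of \<open>W\<close> so that \<open>f\<close> and \<open>g\<close>
  agree on matched elements; then the summands agree on them too.\<close>

lemma sum_cong_image_mset:
  fixes F :: "'v \<Rightarrow> 'c::comm_monoid_add" and F' :: "'w \<Rightarrow> 'c"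
  assumes "image_mset f (mset_set V) = image_mset g (mset_set W)"
    and "finite V" and "finite W"
    and "\<And>x y. x \<in> V \<Longrightarrow> y \<in> W \<Longrightarrow> f x = g y \<Longrightarrow> F x = F' y"
  shows "(\<Sum>x\<in>V. F x) = (\<Sum>y\<in>W. F' y)"
proof -
  have "rel_mset (\<lambda>x y. f x = g y) (mset_set V) (mset_set W)"
    using assms(1) unfolding multiset.rel_eq[symmetric] multiset.rel_map .
  then have "rel_mset (\<lambda>x y. F x = F' y) (mset_set V) (mset_set W)"
    by (rule multiset.rel_mono_strong) (use assms in auto)
  then have "image_mset F (mset_set V) = image_mset F' (mset_set W)"
    unfolding multiset.rel_eq[symmetric] multiset.rel_map .
  then show ?thesis by (simp add: sum_unfold_sum_mset)
qed

lemma atomic_type_pair_eqD: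
  assumes "atomic_type A [u, v] = atomic_type B [u', v']"
  shows "u = v \<longleftrightarrow> u' = v'" and "A u v = B u' v'" and "A v u = B v' u'"
  using assms by (auto simp: atomic_type_def split: if_splits)

text \<open>A refined color stores the color of the previous round, so unwinding it leads back to
  the atomic type.\<close>

lemma wl_coloring_eq_imp_atomic_type_eq:
  "wl_coloring V A r xs = wl_coloring W B r ys \<Longrightarrow> atomic_type A xs = atomic_type B ys"
  by (induction r) auto

lemma wl_coloring_pair_Suc_eqD:
  assumes "wl_coloring V A (Suc r) [u, v] = wl_coloring W B (Suc r) [u', v']"
  shows "wl_coloring V A r [u, v] = wl_coloring W B r [u', v']"
    and "image_mset (\<lambda>m. (wl_coloring V A r [u, m], wl_coloring V A r [m, v])) (mset_set V) =
         image_mset (\<lambda>m. (wl_coloring W B r [u', m], wl_coloring W B r [m, v'])) (mset_set W)"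
proof -
  show "wl_coloring V A r [u, v] = wl_coloring W B r [u', v']"
    using assms by simp
  \<comment> \<open>\<open>rev [0..<2]\<close> replaces the second entry first, hence the order
    \<open>[u, m]\<close>, \<open>[m, v]\<close>. The projection below forgets the atomic types and
    turns the lists into pairs.\<close>
  have "image_mset (\<lambda>m. (atomic_type A [u, v, m], [wl_coloring V A r [u, m], wl_coloring V A r [m, v]])) (mset_set V) =
    image_mset (\<lambda>m. (atomic_type B [u', v', m], [wl_coloring W B r [u', m], wl_coloring W B r [m, v']])) (mset_set W)"
    using assms by (simp add: numeral_2_eq_2)
  from arg_cong[OF this, of "image_mset (\<lambda>p. (snd p ! 0, snd p ! 1))"]
  show "image_mset (\<lambda>m. (wl_coloring V A r [u, m], wl_coloring V A r [m, v])) (mset_set V) =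
         image_mset (\<lambda>m. (wl_coloring W B r [u', m], wl_coloring W B r [m, v'])) (mset_set W)"
    by (simp add: multiset.map_comp comp_def)
qed

text \<open>The form in which refinement is used from here on: at the price of one round, a sum over
  \<open>m\<close> is determined once its summand is determined by the colors of
  \<open>(u, m)\<close> and \<open>(m, v)\<close>.\<close>

lemma wl_coloring_pair_eq_imp_sum_eq:
  fixes F :: "'v \<Rightarrow> 'c::comm_monoid_add" and F' :: "'w \<Rightarrow> 'c"
  assumes "wl_coloring V A (Suc r) [u, v] = wl_coloring W B (Suc r) [u', v']"
    and "finite V" and "finite W"
    and "\<And>m m'. m \<in> V \<Longrightarrow> m' \<in> W \<Longrightarrow>
           wl_coloring V A r [u, m] = wl_coloring W B r [u', m'] \<Longrightarrow>
           wl_coloring V A r [m, v] = wl_coloring W B r [m', v'] \<Longrightarrow> F m = F' m'"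
  shows "(\<Sum>m\<in>V. F m) = (\<Sum>m\<in>W. F' m)"
  by (rule sum_cong_image_mset[OF wl_coloring_pair_Suc_eqD(2)[OF assms(1)] assms(2,3)])
    (use assms(4) in auto)

lemma wl_coloring_pair_eq_imp_entry_eq:
  assumes "wl_coloring V A r [u, v] = wl_coloring W B r [u', v']"
  shows "A u v = B u' v'" and "A v u = B v' u'"
  using atomic_type_pair_eqD[OF wl_coloring_eq_imp_atomic_type_eq[OF assms]] by auto

text \<open>Split off the last step of a walk at \<open>m\<close>: one of the two colors involving
  \<open>m\<close> gives the shorter count by induction, the other the matrix entry. Each step costs
  one round, whence \<open>k \<le> r\<close>. The reversed count serves the profile of the second
  vertex of a pair.\<close>

lemma wl_coloring_pair_eq_imp_walks_eq:
  assumes "finite V" and "finite W"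
    and "wl_coloring V A r [u, v] = wl_coloring W B r [u', v']" and "k \<le> r"
  shows "walks V A k u v = walks W B k u' v'" and "walks V A k v u = walks W B k v' u'"
  using assms(3,4)
proof (induction k arbitrary: r u v u' v')
  case 0
  {
    case 1
    show ?case using atomic_type_pair_eqD(1)[OF wl_coloring_eq_imp_atomic_type_eq[OF 1(1)]] by simp
  next
    case 2
    show ?case using atomic_type_pair_eqD(1)[OF wl_coloring_eq_imp_atomic_type_eq[OF 2(1)]] by auto
  }
next
  case (Suc k)
  {
    case 1
    then obtain s where r: "r = Suc s" "k \<le> s" by (cases r) auto
    show ?case unfolding walks.simps
      by (rule wl_coloring_pair_eq_imp_sum_eq[OF 1(1)[unfolded r(1)] assms(1,2)])
        (rule arg_cong2[where f = "(*)"], rule Suc.IH(1)[OF _ r(2)], assumption,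
         rule wl_coloring_pair_eq_imp_entry_eq(1)[where A = A and B = B], assumption)
  next
    case 2
    then obtain s where r: "r = Suc s" "k \<le> s" by (cases r) auto
    show ?case unfolding walks.simps
      by (rule wl_coloring_pair_eq_imp_sum_eq[OF 2(1)[unfolded r(1)] assms(1,2)])
        (rule arg_cong2[where f = "(*)"], rule Suc.IH(2)[OF _ r(2)], assumption,
         rule wl_coloring_pair_eq_imp_entry_eq(2)[where A = A and B = B], assumption)
  }
qed

lemma wl_coloring_pair_eq_imp_degree_eq:
  assumes "finite V" and "finite W"
    and "wl_coloring V A (Suc r) [u, v] = wl_coloring W B (Suc r) [u', v']"
  shows "(\<Sum>m\<in>V. A u m) = (\<Sum>m\<in>W. B u' m)" and "(\<Sum>m\<in>V. A v m) = (\<Sum>m\<in>W. B v' m)"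
proof -
  show "(\<Sum>m\<in>V. A u m) = (\<Sum>m\<in>W. B u' m)"
    by (rule wl_coloring_pair_eq_imp_sum_eq[OF assms(3,1,2)])
      (rule wl_coloring_pair_eq_imp_entry_eq(1)[where A = A and B = B], assumption)
  show "(\<Sum>m\<in>V. A v m) = (\<Sum>m\<in>W. B v' m)"
    by (rule wl_coloring_pair_eq_imp_sum_eq[OF assms(3,1,2)])
      (rule wl_coloring_pair_eq_imp_entry_eq(2)[where A = A and B = B], assumption)
qed

text \<open>One round pays for the sum over the end vertex \<open>m\<close>. The remaining
  \<open>Suc (card V)\<close> rounds suffice for walks of length below \<open>card V\<close> and for
  the degree of \<open>m\<close>. Equal cardinalities make the cutoffs of both profiles
  agree.\<close>

lemma wl_coloring_pair_eq_imp_walk_profile_eq: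
  assumes "finite V" and "finite W" and "card V = card W"
    and eq: "wl_coloring V A (Suc (Suc (card V))) [u, v] = wl_coloring W B (Suc (Suc (card V))) [u', v']"
  shows "walk_profile V A u = walk_profile W B u'" and "walk_profile V A v = walk_profile W B v'"
proof -
  have "(\<Sum>m\<in>V. walks V A k u m * (if (\<Sum>x\<in>V. A m x) = d then 1 else 0)) =
      (\<Sum>m\<in>W. walks W B k u' m * (if (\<Sum>x\<in>W. B m x) = d then 1 else 0))"
    if "k < card V" for k d
  proof (rule wl_coloring_pair_eq_imp_sum_eq[OF eq assms(1,2)])
    fix m m' assume *: "wl_coloring V A (Suc (card V)) [u, m] = wl_coloring W B (Suc (card V)) [u', m']"
    have "k \<le> Suc (card V)" using that by simp
    from wl_coloring_pair_eq_imp_walks_eq(1)[OF assms(1,2) * this]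
      wl_coloring_pair_eq_imp_degree_eq(2)[OF assms(1,2) *]
    show "walks V A k u m * (if (\<Sum>x\<in>V. A m x) = d then 1 else 0) =
        walks W B k u' m' * (if (\<Sum>x\<in>W. B m' x) = d then 1 else 0)"
      by (simp only:)
  qed
  then show "walk_profile V A u = walk_profile W B u'"
    using assms(3) by (auto simp: walk_profile_def fun_eq_iff)
  have "(\<Sum>m\<in>V. walks V A k v m * (if (\<Sum>x\<in>V. A m x) = d then 1 else 0)) =
      (\<Sum>m\<in>W. walks W B k v' m * (if (\<Sum>x\<in>W. B m x) = d then 1 else 0))"
    if "k < card V" for k d
  proof (rule wl_coloring_pair_eq_imp_sum_eq[OF eq assms(1,2)])
    fix m m' assume *: "wl_coloring V A (Suc (card V)) [m, v] = wl_coloring W B (Suc (card V)) [m', v']"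
    have "k \<le> Suc (card V)" using that by simp
    from wl_coloring_pair_eq_imp_walks_eq(2)[OF assms(1,2) * this]
      wl_coloring_pair_eq_imp_degree_eq(1)[OF assms(1,2) *]
    show "walks V A k v m * (if (\<Sum>x\<in>V. A m x) = d then 1 else 0) =
        walks W B k v' m' * (if (\<Sum>x\<in>W. B m' x) = d then 1 else 0)"
      by (simp only:)
  qed
  then show "walk_profile V A v = walk_profile W B v'"
    using assms(3) by (auto simp: walk_profile_def fun_eq_iff)
qed

section \<open>Isomorphism from separating profiles\<close>

lemma wl_equivalent_imp_wl_multiset_eq:
  assumes "wl_equivalent k G H"
  shows "wl_multiset (pverts G) (adjacency G) k r = wl_multiset (pverts H) (adjacency H) k r"
  \<comment> \<open>The index is \<open>Suc r\<close> because the series numbers rounds from 1 and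
    \<open>wl_coloring\<close> from 0.\<close>
  using arg_cong[OF assms[unfolded wl_equivalent_def], of "\<lambda>F. fps_nth F (Suc r)"]
  by (simp add: wl_series_def)

text \<open>Equal multisets have equal supports, so every color of a pair over \<open>V\<close> also
  occurs over \<open>W\<close>.\<close>

lemma wl_multiset_eq_imp_ex_pair:
  assumes "wl_multiset V A 2 r = wl_multiset W B 2 r" and "finite V" and "finite W"
    and "u \<in> V" and "v \<in> V"
  obtains u' v' where "u' \<in> W" and "v' \<in> W"
    and "wl_coloring V A r [u, v] = wl_coloring W B r [u', v']"
proof -
  have fin: "finite {xs. set xs \<subseteq> X \<and> length xs = 2}" if "finite X" for X :: "'x set"
    using finite_lists_length_eq[OF that] .
  have "wl_coloring V A r ` {xs. set xs \<subseteq> V \<and> length xs = 2} =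
      wl_coloring W B r ` {xs. set xs \<subseteq> W \<and> length xs = 2}"
    using arg_cong[OF assms(1), of set_mset]
    by (simp only: wl_multiset_def set_image_mset finite_set_mset_mset_set[OF fin] assms(2,3))
  moreover have "[u, v] \<in> {xs. set xs \<subseteq> V \<and> length xs = 2}"
    using assms(4,5) by simp
  ultimately have "wl_coloring V A r [u, v] \<in> wl_coloring W B r ` {xs. set xs \<subseteq> W \<and> length xs = 2}"
    by blast
  then obtain ys where ys: "set ys \<subseteq> W" "length ys = 2"
    and eq: "wl_coloring V A r [u, v] = wl_coloring W B r ys"
    by blast
  obtain u' v' where "ys = [u', v']"
    using ys(2) by (auto simp: numeral_2_eq_2 length_Suc_conv)
  then show ?thesis using that[of u' v'] ys(1) eq by simp
qed

text \<open>Arcs are pairs of vertices, so \<open>f\<close> induces the arc map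
  \<open>map_prod f f\<close>. It reaches every arc of \<open>H\<close> because both ends of such an
  arc are images under \<open>f\<close>.\<close>

lemma digraph_iso_with_projI:
  assumes "pair_wf_digraph G" and "pair_wf_digraph H"
    and f: "bij_betw f (pverts G) (pverts H)"
    and arcs: "\<And>u v. u \<in> pverts G \<Longrightarrow> v \<in> pverts G \<Longrightarrow>
      (u, v) \<in> parcs G \<longleftrightarrow> (f u, f v) \<in> parcs H"
  shows "digraph_iso (with_proj G) (with_proj H)"
proof -
  interpret G: pair_wf_digraph G by fact
  interpret H: pair_wf_digraph H by fact
  let ?h = "\<lparr>iso_verts = f, iso_arcs = map_prod f f, iso_head = snd, iso_tail = fst\<rparr>"
  have "inj_on (map_prod f f) (parcs G)"
    by (rule inj_on_subset[OF map_prod_inj_on])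
      (use f in \<open>auto simp: bij_betw_def dest: G.in_arcsD1 G.in_arcsD2\<close>)
  then have "pre_digraph.digraph_isomorphism (with_proj G) ?h"
    using f G.wf_digraph_axioms by (auto simp: pre_digraph.digraph_isomorphism_def bij_betw_def)
  moreover have "map_prod f f ` parcs G = parcs H"
  proof (intro equalityI subsetI)
    fix e assume "e \<in> map_prod f f ` parcs G"
    then show "e \<in> parcs H" using arcs by (auto dest: G.in_arcsD1 G.in_arcsD2)
  next
    fix e assume e: "e \<in> parcs H"
    then have "fst e \<in> f ` pverts G" "snd e \<in> f ` pverts G"
      using H.arc_fst_in_verts H.arc_snd_in_verts f by (auto simp: bij_betw_def)
    then obtain u v where uv: "u \<in> pverts G" "v \<in> pverts G" "e = (f u, f v)"
      by (metis imageE prod.collapse)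
    then have "(u, v) \<in> parcs G" using arcs e by simp
    then show "e \<in> map_prod f f ` parcs G" using uv(3) by force
  qed
  then have "with_proj H = app_iso ?h (with_proj G)"
    using f by (simp add: app_iso_def with_proj_def bij_betw_def)
  ultimately show ?thesis unfolding digraph_iso_def by blast
qed

lemma digraph_iso_if_inj_on_walk_profile:
  assumes G: "pair_fin_digraph G" and H: "pair_fin_digraph H"
    and card: "card (pverts G) = card (pverts H)"
    and wl: "wl_equivalent 2 G H"
    and inj: "inj_on (walk_profile (pverts G) (adjacency G)) (pverts G)"
  shows "digraph_iso (with_proj G) (with_proj H)"
proof -
  interpret G: pair_fin_digraph G by fact
  interpret H: pair_fin_digraph H by fact
  let ?p = "walk_profile (pverts G) (adjacency G)"
  let ?q = "walk_profile (pverts H) (adjacency H)"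
  note fin = G.pair_finite_verts H.pair_finite_verts
  have ex: "\<exists>u'\<in>pverts H. \<exists>v'\<in>pverts H. ?q u' = ?p u \<and> ?q v' = ?p v \<and>
      adjacency H u' v' = adjacency G u v" if "u \<in> pverts G" "v \<in> pverts G" for u v
  proof -
    obtain u' v' where uv: "u' \<in> pverts H" "v' \<in> pverts H"
      and eq: "wl_coloring (pverts G) (adjacency G) (Suc (Suc (card (pverts G)))) [u, v] =
        wl_coloring (pverts H) (adjacency H) (Suc (Suc (card (pverts G)))) [u', v']"
      by (rule wl_multiset_eq_imp_ex_pair[OF wl_equivalent_imp_wl_multiset_eq[OF wl] fin \<open>u \<in> pverts G\<close> \<open>v \<in> pverts G\<close>])
    show ?thesis
      using uv wl_coloring_pair_eq_imp_walk_profile_eq[OF fin card eq]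
        wl_coloring_pair_eq_imp_entry_eq(1)[OF eq] by metis
  qed
  have sub: "?p ` pverts G \<subseteq> ?q ` pverts H"
    using ex by (metis image_eqI image_subsetI)
  have card_p: "card (?p ` pverts G) = card (pverts H)"
    using card_image[OF inj] card by simp
  \<comment> \<open>The profiles in \<open>H\<close> include the \<open>card (pverts H)\<close> many
    profiles of \<open>G\<close>, and there cannot be more of them than vertices; this forces
    \<open>?q\<close> to be injective.\<close>
  have "card (?q ` pverts H) = card (pverts H)"
    using card_mono[OF finite_imageI[OF fin(2)] sub] card_image_le[OF fin(2), of ?q] card_p
    by linarith
  then have inj_q: "inj_on ?q (pverts H)" and im: "?p ` pverts G = ?q ` pverts H"
    using eq_card_imp_inj_on[OF fin(2)] card_subset_eq[OF finite_imageI[OF fin(2)] sub] card_p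
    by auto
  \<comment> \<open>Sends \<open>u\<close> to the unique vertex of \<open>H\<close> with the same
    profile.\<close>
  let ?f = "the_inv_into (pverts H) ?q \<circ> ?p"
  have bij: "bij_betw ?f (pverts G) (pverts H)"
    by (rule bij_betw_trans[OF _ bij_betw_the_inv_into])
      (use inj inj_q im in \<open>auto simp: bij_betw_def\<close>)
  have f: "?f u = u'" if "u' \<in> pverts H" "?q u' = ?p u" for u u'
    using the_inv_into_f_f[OF inj_q that(1)] that(2) by simp
  show ?thesis
  proof (rule digraph_iso_with_projI[OF _ _ bij])
    fix u v assume "u \<in> pverts G" "v \<in> pverts G"
    \<comment> \<open>The pair supplied by \<open>ex\<close> has the profiles of \<open>u\<close>
      and \<open>v\<close>, so it must be \<open>(?f u, ?f v)\<close>.\<close>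
    from ex[OF this] have "adjacency H (?f u) (?f v) = adjacency G u v"
      using f by metis
    then show "(u, v) \<in> parcs G \<longleftrightarrow> (?f u, ?f v) \<in> parcs H"
      by (simp add: adjacency_def split: if_splits)
  qed unfold_locales
qed

section \<open>The walk matrix\<close>

lemma row_eq_imp_mult_mat_entry_eq:
  assumes "row A i = row A j" and "i < dim_row A" and "j < dim_row A" and "k < dim_col B"
  shows "(A * B) $$ (i, k) = (A * B) $$ (j, k)"
  using assms by simp

text \<open>The adjugate stands in for an inverse: equal rows \<open>i\<close> and \<open>j\<close>
  of \<open>U\<close> give equal rows of \<open>U * adj_mat U\<close>, which is \<open>det U\<close>
  times the identity.\<close>

lemma row_inj_if_det_neq_0:
  fixes U :: "'a::idom mat"
  assumes U: "U \<in> carrier_mat n n" and "det U \<noteq> 0" and "i < n" and "j < n" and "row U i = row U j"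
  shows "i = j"
proof -
  have "(U * adj_mat U) $$ (i, i) = (U * adj_mat U) $$ (j, i)"
    using assms adj_mat(1)[OF U] by (intro row_eq_imp_mult_mat_entry_eq) auto
  then show ?thesis using assms by (simp add: adj_mat(2)[OF U] split: if_splits)
qed

text \<open>Write \<open>M = U * S * V\<close>. Cancelling \<open>V\<close> by its adjugate and then
  the nonzero diagonal of \<open>S\<close> turns equal rows of \<open>M\<close> into equal rows of
  \<open>U\<close>, whose determinant is nonzero.\<close>

lemma row_inj_if_last_invariant_factor_neq_0:
  assumes "last_invariant_factor M d" and "d \<noteq> 0" and "dim_row M \<le> dim_col M"
    and "i < dim_row M" and "j < dim_row M" and "row M i = row M j"
  shows "i = j"
proof -
  let ?n = "dim_row M" and ?m = "dim_col M"
  have min: "min ?n ?m = ?n" using assms(3) by simp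
  obtain S where S: "smith_normal_form M S" and d: "d = S $$ (?n - 1, ?n - 1)"
    using assms(1) unfolding last_invariant_factor_def Let_def min by blast
  then obtain U V where carr: "S \<in> carrier_mat ?n ?m" "U \<in> carrier_mat ?n ?n" "V \<in> carrier_mat ?m ?m"
    and diag: "diagonal_mat S"
    and dvd: "\<And>i. Suc i < ?n \<Longrightarrow> S $$ (i, i) dvd S $$ (Suc i, Suc i)"
    and det': "det U \<in> {1, -1}" "det V \<in> {1, -1}" and M: "M = U * S * V"
    unfolding smith_normal_form_def Let_def min by blast
  have det: "det U \<noteq> 0" "det V \<noteq> 0"
    using det' by auto
  \<comment> \<open>Every diagonal entry divides the last one, \<open>d\<close>, and 0 divides only
    0.\<close>
  have S_nz: "S $$ (k, k) \<noteq> 0" if "k < ?n" for k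
  proof -
    have "k \<le> ?n - 1" using that by simp
    then have "S $$ (k, k) dvd d"
      unfolding d by (induction rule: inc_induct) (use dvd in \<open>auto intro: dvd_trans\<close>)
    then show ?thesis using assms(2) by auto
  qed
  \<comment> \<open>Since \<open>S\<close> is diagonal, column \<open>k\<close> of
    \<open>U * S\<close> is a multiple of column \<open>k\<close> of \<open>U\<close>.\<close>
  have US: "(U * S) $$ (l, k) = U $$ (l, k) * S $$ (k, k)" if "l < ?n" "k < ?n" for l k
  proof -
    have "(U * S) $$ (l, k) = (\<Sum>x = 0..<?n. U $$ (l, x) * S $$ (x, k))"
      using that carr assms(3) by (simp add: scalar_prod_def)
    also have "\<dots> = (\<Sum>x = 0..<?n. if x = k then U $$ (l, k) * S $$ (k, k) else 0)"
      using that carr assms(3) diag by (intro sum.cong) (auto simp: diagonal_mat_def)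
    finally show ?thesis using that by simp
  qed
  have MV: "M * adj_mat V = det V \<cdot>\<^sub>m (U * S)"
  proof -
    have "M * adj_mat V = U * S * (V * adj_mat V)"
      unfolding M using carr adj_mat(1)[OF carr(3)]
      by (intro assoc_mult_mat[of _ ?n ?m _ ?m _ ?m]) auto
    also have "\<dots> = U * S * (det V \<cdot>\<^sub>m 1\<^sub>m ?m)"
      using adj_mat(2)[OF carr(3)] by simp
    also have "\<dots> = det V \<cdot>\<^sub>m (U * S)"
      using carr mult_smult_distrib[of "U * S" ?n ?m "1\<^sub>m ?m" ?m "det V"] by simp
    finally show ?thesis .
  qed
  have "U $$ (i, k) = U $$ (j, k)" if k: "k < ?n" for k
  proof -
    have "(M * adj_mat V) $$ (i, k) = (M * adj_mat V) $$ (j, k)"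
      using assms k adj_mat(1)[OF carr(3)] by (intro row_eq_imp_mult_mat_entry_eq) auto
    then have "det V * (U $$ (i, k) * S $$ (k, k)) = det V * (U $$ (j, k) * S $$ (k, k))"
      using assms k carr by (simp add: MV US del: index_mult_mat(1))
    then show ?thesis using det(2) S_nz[OF k] by simp
  qed
  then have "row U i = row U j" using carr assms by (intro eq_vecI) auto
  then show ?thesis using row_inj_if_det_neq_0[OF carr(2) det(1) assms(4,5)] by simp
qed

section \<open>Rows of the walk matrix as walk profiles\<close>

lemma adjacency_mat_pow_entry:
  assumes "vertex_enumeration G us" and "i < length us" and "j < length us"
  shows "(adjacency_mat G us ^\<^sub>m k) $$ (i, j) = walks (pverts G) (adjacency G) k (us ! i) (us ! j)"
  using assms(3)
proof (induction k arbitrary: j)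
  case 0
  then show ?case
    using assms nth_eq_iff_index_eq[of us i j] by (auto simp: vertex_enumeration_def adjacency_mat_def)
next
  case (Suc k)
  have carr: "adjacency_mat G us \<in> carrier_mat (length us) (length us)"
    by (simp add: adjacency_mat_def)
  have bij: "bij_betw ((!) us) {0..<length us} (pverts G)"
    using assms(1) bij_betw_nth[of us] by (simp add: vertex_enumeration_def lessThan_atLeast0)
  have "(adjacency_mat G us ^\<^sub>m Suc k) $$ (i, j) =
      (\<Sum>l = 0..<length us. (adjacency_mat G us ^\<^sub>m k) $$ (i, l) * adjacency_mat G us $$ (l, j))"
    using assms Suc.prems carr pow_carrier_mat[OF carr, of k] by (simp add: scalar_prod_def)
  also have "\<dots> = (\<Sum>l = 0..<length us. walks (pverts G) (adjacency G) k (us ! i) (us ! l) *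
      adjacency G (us ! l) (us ! j))"
    using Suc by (intro sum.cong) (auto simp: adjacency_mat_def)
  also have "\<dots> = walks (pverts G) (adjacency G) (Suc k) (us ! i) (us ! j)"
    unfolding walks.simps by (rule sum.reindex_bij_betw[OF bij])
  finally show ?case .
qed

text \<open>Links the degree cells to the row sums by which \<open>walk_profile\<close> recognizes
  degrees.\<close>

lemma out_degree_eq_sum_adjacency:
  assumes "pair_fin_digraph G"
  shows "int (out_degree (with_proj G) v) = (\<Sum>m\<in>pverts G. adjacency G v m)"
proof -
  interpret pair_fin_digraph G by fact
  have "out_arcs (with_proj G) v = Pair v ` {m \<in> pverts G. (v, m) \<in> parcs G}"
    by (auto simp: out_arcs_def dest: in_arcsD2)
  then have "out_degree (with_proj G) v = card {m \<in> pverts G. (v, m) \<in> parcs G}"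
    by (simp add: out_degree_def card_image inj_on_def)
  then show ?thesis
    using pair_finite_verts by (simp add: adjacency_def sum.If_cases Int_def)
qed

text \<open>The column for cell \<open>C\<close> and power \<open>k\<close> has at the position of a
  vertex the value of its profile at \<open>k\<close> and the common degree of \<open>C\<close>; so
  the profile determines the row.\<close>

lemma walk_matrix_row_eq:
  assumes G: "pair_fin_digraph G" and us: "vertex_enumeration G us" and Us: "degree_cell_enumeration G Us"
    and ij: "i < length us" "j < length us"
    and eq: "walk_profile (pverts G) (adjacency G) (us ! i) = walk_profile (pverts G) (adjacency G) (us ! j)"
  shows "row (walk_matrix G us Us) i = row (walk_matrix G us Us) j"
proof -
  let ?n = "length us"
  let ?cols = "concat (map (\<lambda>C. map (\<lambda>k. (adjacency_mat G us ^\<^sub>m k) *\<^sub>v char_vec us C) [0..<?n]) Us)"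
  have card: "card (pverts G) = ?n"
    using us distinct_card[of us] by (simp add: vertex_enumeration_def)
  have carr: "adjacency_mat G us \<in> carrier_mat ?n ?n" by (simp add: adjacency_mat_def)
  have bij: "bij_betw ((!) us) {0..<?n} (pverts G)"
    using us bij_betw_nth[of us] by (simp add: vertex_enumeration_def lessThan_atLeast0)
  have "c $ i = c $ j" if c: "c \<in> set ?cols" for c
  proof -
    obtain C k where C: "C \<in> set Us" and k: "k < ?n"
      and c: "c = (adjacency_mat G us ^\<^sub>m k) *\<^sub>v char_vec us C"
      using c by auto
    \<comment> \<open>\<open>w\<close> represents the cell; its degree \<open>?d\<close> is the
      profile index replacing \<open>C\<close>.\<close>
    obtain w where w: "C = {u \<in> pverts G. out_degree (with_proj G) u = out_degree (with_proj G) w}"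
      using C Us by (auto simp: degree_cell_enumeration_def degree_partition_def)
    let ?d = "\<Sum>m\<in>pverts G. adjacency G w m"
    have "c $ l = walk_profile (pverts G) (adjacency G) (us ! l) k ?d" if l: "l < ?n" for l
    proof -
      have "c $ l = (\<Sum>x = 0..<?n. (adjacency_mat G us ^\<^sub>m k) $$ (l, x) * (if us ! x \<in> C then 1 else 0))"
        using l carrier_matD[OF pow_carrier_mat[OF carr, of k]] by (simp add: c scalar_prod_def char_vec_def)
      also have "\<dots> = (\<Sum>x = 0..<?n. walks (pverts G) (adjacency G) k (us ! l) (us ! x) *
          (if us ! x \<in> C then 1 else 0))"
        using adjacency_mat_pow_entry[OF us l] by (intro sum.cong) auto
      also have "\<dots> = (\<Sum>v\<in>pverts G. walks (pverts G) (adjacency G) k (us ! l) v * (if v \<in> C then 1 else 0))"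
        by (rule sum.reindex_bij_betw[OF bij])
      also have "\<dots> = (\<Sum>v\<in>pverts G. walks (pverts G) (adjacency G) k (us ! l) v *
          (if (\<Sum>m\<in>pverts G. adjacency G v m) = ?d then 1 else 0))"
        by (intro sum.cong) (auto simp: w out_degree_eq_sum_adjacency[OF G, symmetric])
      finally show ?thesis using k by (simp add: walk_profile_def card)
    qed
    then show ?thesis using ij eq by simp
  qed
  then have "(?cols ! x) $ i = (?cols ! x) $ j" if "x < length ?cols" for x
    using nth_mem[OF that] by blast
  then show ?thesis
    using ij by (intro eq_vecI) (auto simp: walk_matrix_def Let_def mat_of_cols_index)
qed

lemma walk_matrix_dim:
  "dim_row (walk_matrix G us Us) = length us"
  "dim_col (walk_matrix G us Us) = length us * length Us"
  by (simp_all add: walk_matrix_def Let_def length_concat comp_def sum_list_triv)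

lemma inj_on_walk_profile:
  assumes G: "pair_fin_digraph G" and us: "vertex_enumeration G us" and Us: "degree_cell_enumeration G Us"
    and d: "last_invariant_factor (walk_matrix G us Us) d" "d \<noteq> 0"
  shows "inj_on (walk_profile (pverts G) (adjacency G)) (pverts G)"
proof (rule inj_onI)
  fix u v assume uv: "u \<in> pverts G" "v \<in> pverts G"
    and eq: "walk_profile (pverts G) (adjacency G) u = walk_profile (pverts G) (adjacency G) v"
  obtain i j where ij: "i < length us" "j < length us" and u: "u = us ! i" and v: "v = us ! j"
    using uv us by (metis in_set_conv_nth vertex_enumeration_def)
  \<comment> \<open>A last invariant factor exists only if there are columns, so there is at least
    one cell, and the matrix is at least as wide as it is high.\<close>
  have "0 < length Us"
    using d(1) by (auto simp: last_invariant_factor_def walk_matrix_dim)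
  then have "dim_row (walk_matrix G us Us) \<le> dim_col (walk_matrix G us Us)"
    by (cases Us) (simp_all add: walk_matrix_dim)
  from row_inj_if_last_invariant_factor_neq_0[OF d this, of i j]
  show "u = v"
    using ij u v eq walk_matrix_row_eq[OF G us Us ij] by (simp add: walk_matrix_dim)
qed

lemma digraph_iso_if_last_invariant_factor_neq_0:
  assumes "pair_fin_digraph G" and "pair_fin_digraph H" and "card (pverts G) = card (pverts H)"
    and "vertex_enumeration G us" and "degree_cell_enumeration G Us" and "wl_equivalent 2 G H"
    and "last_invariant_factor (walk_matrix G us Us) d" and "d \<noteq> 0"
  shows "digraph_iso (with_proj G) (with_proj H)"
  using digraph_iso_if_inj_on_walk_profile inj_on_walk_profile assms by blast

theorem theorem1p1:
  fixes G :: "'a pair_pre_digraph" and H :: "'b pair_pre_digraph" and n :: nat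
    and us :: "'a list" and Us :: "'a set list"
    and vs :: "'b list" and Vs :: "'b set list"
  assumes "pair_graph G" and "pair_graph H"
    and "card (pverts G) = n" and "card (pverts H) = n"
    and "vertex_enumeration G us" and "degree_cell_enumeration G Us"
    and "vertex_enumeration H vs" and "degree_cell_enumeration H Vs"
    and "wl_equivalent 2 G H"
  shows
    "(\<forall>d. last_invariant_factor (walk_matrix G us Us) d \<longrightarrow>
        (odd d \<and> (\<forall>q::int. prime q \<and> odd q \<and> q dvd d \<longrightarrow>
                     \<not> dvd_discriminant (q\<^sup>2) (adjacency_mat G us))
           \<longrightarrow> digraph_iso (with_proj G) (with_proj H)) \<and>
        (d = 1 \<longrightarrow> digraph_iso (with_proj G) (with_proj H))) \<and>
     (\<forall>d. last_invariant_factor (walk_matrix H vs Vs) d \<longrightarrow>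
        (odd d \<and> (\<forall>q::int. prime q \<and> odd q \<and> q dvd d \<longrightarrow>
                     \<not> dvd_discriminant (q\<^sup>2) (adjacency_mat H vs))
           \<longrightarrow> digraph_iso (with_proj G) (with_proj H)) \<and>
        (d = 1 \<longrightarrow> digraph_iso (with_proj G) (with_proj H)))"
proof -
  interpret G: pair_graph G by fact
  interpret H: pair_graph H by fact
  note fin = G.pair_fin_digraph_axioms H.pair_fin_digraph_axioms
  have card: "card (pverts G) = card (pverts H)" using assms(3,4) by simp
  have iso_G: "digraph_iso (with_proj G) (with_proj H)"
    if "last_invariant_factor (walk_matrix G us Us) d" "d \<noteq> 0" for d
    by (rule digraph_iso_if_last_invariant_factor_neq_0[OF fin card assms(5,6,9) that])
  have iso_H: "digraph_iso (with_proj G) (with_proj H)"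
    if "last_invariant_factor (walk_matrix H vs Vs) d" "d \<noteq> 0" for d
  \<comment> \<open>The argument with the roles exchanged yields an isomorphism from
    \<open>H\<close> to \<open>G\<close>, which is then inverted.\<close>
  proof (rule digraph_iso_swap[OF H.wf_digraph_axioms])
    have "wl_equivalent 2 H G" using assms(9) by (simp add: wl_equivalent_def)
    then show "digraph_iso (with_proj H) (with_proj G)"
      by (rule digraph_iso_if_last_invariant_factor_neq_0
          [OF fin(2,1) card[symmetric] assms(7,8) _ that])
  qed
  \<comment> \<open>0 is even, so an odd \<open>d\<close> is nonzero.\<close>
  have "d \<noteq> 0" if "odd d \<or> d = 1" for d :: int
    using that by auto
  then show ?thesis using iso_G iso_H by blast
qed

end
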